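(* Let $\mathcal{H}$ be an infinite-dimensional real Hilbert space with inner product $\langle\cdot,\cdot\rangle$ and norm $\|x\|=\langle x,x\rangle^{1/2}$. The metric compactification $\overline{\mathcal{H}}^{h}=\overline{\mathcal{H}}^{h,F}\sqcup\overline{\mathcal{H}}^{h,\infty}$ of $\mathcal{H}$ is given by $$\overline{\mathcal{H}}^{h,F}=\left\{h^{\{z,c\}}\in\mathbb{R}^{\mathcal{H}}\;\middle|\; z\in\mathcal{H},\ c\geq\|z\|\right\}\cup\{0\},$$ $$\overline{\mathcal{H}}^{h,\infty}=\left\{h^{\{z\}}\in\mathbb{R}^{\mathcal{H}}\;\middle|\; z\in\mathcal{H},\ 0<\|z\|\leq 1\right\},$$ where for every $x\in\mathcal{H}$ $$h^{\{z,c\}}(x)=\left(\|x\|^{2}-2\langle x,z\rangle+c^{2}\right)^{1/2}-c,\qquad h^{\{z\}}(x)=-\langle x,z\rangle .$$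
   Context: Metric compactification: for a Banach space $(X,\|\cdot\|)$ and $y\in X$, let $h_y:X\to\mathbb{R}$, $h_y(x)=\|x-y\|-\|y\|$. The metric compactification $\overline{X}^{h}$ of $X$ is the closure of $\{h_y\mid y\in X\}$ in $\mathbb{R}^X$ with the product topology (the topology of pointwise convergence). It is partitioned as $\overline{X}^{h}=\overline{X}^{h,F}\sqcup\overline{X}^{h,\infty}$, where $\overline{X}^{h,F}:=\{h\in\overline{X}^{h}\mid \inf_{x\in X}h(x)>-\infty\}$ (finite metric functionals) and $\overline{X}^{h,\infty}:=\{h\in\overline{X}^{h}\mid \inf_{x\in X}h(x)=-\infty\}$ (metric functionals at infinity). Here $0$ denotes the identically zero function, and $c$ is a real number. *)

theory Defs
  imports "HOL-Analysis.Analysis"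
begin

definition internal_functional :: "'a::banach \<Rightarrow> 'a \<Rightarrow> real" where
  "internal_functional y = (\<lambda>x. norm (x - y) - norm y)"

text \<open>The topology that the library puts on a function type \<open>'a \<Rightarrow> real\<close> is the product topology,
  i.e. that of pointwise convergence; the topology of the domain plays no role in it.\<close>

definition metric_compactification :: "('a::banach \<Rightarrow> real) set" where
  "metric_compactification = closure (range internal_functional)"

text \<open>The infima are taken in the extended reals, where they exist without any boundedness assumption.\<close>

definition finite_metric_functionals :: "('a::banach \<Rightarrow> real) set" where
  "finite_metric_functionals = {h \<in> metric_compactification. (INF x. ereal (h x)) > -\<infinity>}"

definition metric_functionals_at_infinity :: "('a::banach \<Rightarrow> real) set" where
  "metric_functionals_at_infinity = {h \<in> metric_compactification. (INF x. ereal (h x)) = -\<infinity>}"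

definition hilbert_finite_functional :: "'a::{real_inner, banach} \<Rightarrow> real \<Rightarrow> 'a \<Rightarrow> real" where
  "hilbert_finite_functional z c = (\<lambda>x. sqrt ((norm x)\<^sup>2 - 2 * (x \<bullet> z) + c\<^sup>2) - c)"

definition hilbert_linear_functional :: "'a::{real_inner, banach} \<Rightarrow> 'a \<Rightarrow> real" where
  "hilbert_linear_functional z = (\<lambda>x. - (x \<bullet> z))"

text \<open>Algebraic dimension: no finite set spans the space.  (The library's \<open>dim\<close> is \<open>0\<close> on
  infinite-dimensional spaces, so it cannot be used here.)\<close>

definition infinite_dimensional :: "'a::real_vector itself \<Rightarrow> bool" where
  "infinite_dimensional _ \<longleftrightarrow> \<not> (\<exists>B::'a set. finite B \<and> span B = UNIV)"

end

theory Submission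
  imports Defs "HOL-Real_Asymp.Real_Asymp"
begin

text \<open>
  Put \<open>g = h\<^sub>y(x)\<close>.  Squaring \<open>g + \<parallel>y\<parallel> = \<parallel>x - y\<parallel>\<close> gives
  \<open>2 g \<parallel>y\<parallel> + 2 \<langle>x, y\<rangle> = \<parallel>x\<parallel>\<^sup>2 - g\<^sup>2\<close>, and dividing by \<open>1 + \<parallel>y\<parallel>\<close> makes every coefficient bounded:
  with \<open>s = \<parallel>y\<parallel> / (1 + \<parallel>y\<parallel>) \<in> [0, 1]\<close> and \<open>w = y / (1 + \<parallel>y\<parallel>)\<close>,
  \<open>2 g s + 2 \<langle>x, w\<rangle> = (1 - s) (\<parallel>x\<parallel>\<^sup>2 - g\<^sup>2)\<close>.
  If \<open>h\<close> is a pointwise limit of such functionals along a filter, refine the filter so that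
  \<open>s \<rightarrow> \<sigma>\<close>.  The equation then forces \<open>\<langle>x, w\<rangle>\<close> to converge for every \<open>x\<close>; the limit is linear in
  \<open>x\<close> and bounded by \<open>\<sigma> \<parallel>x\<parallel>\<close>, hence of the form \<open>\<langle>x, z\<rangle>\<close> with \<open>\<parallel>z\<parallel> \<le> \<sigma>\<close>
  (\<open>riesz_representation\<close>).  So weak compactness of balls is replaced by compactness of \<open>[0, 1]\<close>.
  The limiting equation (\<open>metric_functional_rescaled_limit\<close>) determines \<open>h\<close>: for \<open>\<sigma> = 1\<close>, where
  the norms of the points \<open>y\<close> tend to infinity, it is the linear functional of \<open>z\<close>; for \<open>\<sigma> < 1\<close>
  it is the square-root functional of \<open>z / (1 - \<sigma>)\<close> and \<open>c = \<sigma> / (1 - \<sigma>)\<close>, the limit of \<open>\<parallel>y\<parallel>\<close>.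

  Conversely, let \<open>c \<ge> \<parallel>z\<parallel>\<close>.  In infinite dimension a finite set of points and \<open>z\<close> leave room for
  a unit vector \<open>e\<close> orthogonal to all of them, and \<open>y = z + a e\<close> with \<open>a\<close> chosen so that
  \<open>\<parallel>y\<parallel> = c\<close> yields an internal functional equal to the square-root functional of \<open>z\<close>
  and \<open>c\<close> on the finite set.  The linear functionals with \<open>\<parallel>z\<parallel> \<le> 1\<close>, the zero functional
  among them, are limits of the functionals for \<open>(n z, n)\<close> as \<open>n \<rightarrow> \<infinity>\<close>.

  Finally, the square-root functionals are bounded below by \<open>- c\<close>, while among the linear ones
  only the zero functional is bounded below.
\<close>

section \<open>Riesz representation and orthogonal vectors\<close>

text \<open>The representing vector is the minimiser of \<open>\<parallel>x\<parallel>\<^sup>2 - 2 \<phi>(x)\<close>, which would equal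
  \<open>\<parallel>x - z\<parallel>\<^sup>2 - \<parallel>z\<parallel>\<^sup>2\<close>.  By the parallelogram law minimising sequences are Cauchy, so completeness
  gives a minimiser, and the first variation there vanishes.\<close>

lemma riesz_representation:
  fixes \<phi> :: "'a::{real_inner, banach} \<Rightarrow> real"
  assumes "bounded_linear \<phi>"
  obtains z where "\<And>x. \<phi> x = x \<bullet> z"
proof -
  interpret bounded_linear \<phi> by fact
  define J where "J = (\<lambda>x. (norm x)\<^sup>2 - 2 * \<phi> x)"
  obtain K where K: "\<And>x. norm (\<phi> x) \<le> norm x * K"
    using bounded by blast
  have lower: "- K\<^sup>2 \<le> J x" for x
  proof -
    have "\<phi> x \<le> norm x * K" using K[of x] by simp
    moreover have "0 \<le> (norm x - K)\<^sup>2" by simp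
    ultimately show ?thesis unfolding J_def by (simp add: power2_diff)
  qed
  have bdd: "bdd_below (range J)" using lower by (intro bdd_belowI2)
  define m where "m = (INF x. J x)"
  have m_le: "m \<le> J x" for x unfolding m_def by (rule cINF_lower[OF bdd]) simp
  have "\<exists>x. J x < m + 1 / real (Suc n)" for n
    using cINF_less_iff[of UNIV J "m + 1 / real (Suc n)"] bdd by (simp add: m_def)
  then obtain u where u: "\<And>n. J (u n) < m + 1 / real (Suc n)" by metis
  have parallelogram: "(norm (x - y))\<^sup>2 = 2 * J x + 2 * J y - 4 * J ((1/2) *\<^sub>R (x + y))" for x y
    unfolding J_def power2_norm_eq_inner
    by (simp add: algebra_simps inner_commute add scale)
  have close: "(norm (u i - u j))\<^sup>2 \<le> 4 / real (Suc N)" if "N \<le> i" "N \<le> j" for i j N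
  proof -
    have "1 / real (Suc i) \<le> 1 / real (Suc N)" "1 / real (Suc j) \<le> 1 / real (Suc N)"
      using that by (auto simp: frac_le)
    then show ?thesis
      using parallelogram[of "u i" "u j"] u[of i] u[of j] m_le[of "(1/2) *\<^sub>R (u i + u j)"] by linarith
  qed
  have "Cauchy u"
  proof (rule metric_CauchyI)
    fix e :: real assume "0 < e"
    then obtain N where "4 / e\<^sup>2 < real N" using reals_Archimedean2 by blast
    then have "4 / e\<^sup>2 < real (Suc N)" by simp
    then have N: "4 / real (Suc N) < e\<^sup>2" using \<open>0 < e\<close> by (simp add: field_simps)
    have "dist (u i) (u j) < e" if "N \<le> i" "N \<le> j" for i j
      unfolding dist_norm
      using le_less_trans[OF close[OF that] N] \<open>0 < e\<close> by (simp add: power2_less_imp_less)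
    then show "\<exists>M. \<forall>i\<ge>M. \<forall>j\<ge>M. dist (u i) (u j) < e" by blast
  qed
  then obtain z where z: "u \<longlonglongrightarrow> z" using Cauchy_convergent convergent_def by blast
  have "(\<lambda>n. J (u n)) \<longlonglongrightarrow> J z" unfolding J_def by (intro tendsto_intros tendsto z)
  moreover have "(\<lambda>n. m + 1 / real (Suc n)) \<longlonglongrightarrow> m" by real_asymp
  ultimately have Jz: "J z \<le> m" using u by (intro LIMSEQ_le) (auto intro: less_imp_le)
  have "\<phi> x = x \<bullet> z" for x
  proof (cases "x = 0")
    case True
    then show ?thesis by (simp add: zero)
  next
    case False
    define a where "a = x \<bullet> z - \<phi> x"
    have J_line: "J (z + t *\<^sub>R x) = J z + 2 * t * a + t\<^sup>2 * (norm x)\<^sup>2" for t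
      unfolding J_def a_def power2_norm_eq_inner
      by (simp add: algebra_simps inner_commute add scale power2_eq_square)
    have "0 \<le> 2 * t * a + t\<^sup>2 * (norm x)\<^sup>2" for t
      using J_line[of t] m_le[of "z + t *\<^sub>R x"] Jz by linarith
    \<comment> \<open>the value of \<open>t\<close> that minimises the quadratic\<close>
    from this[of "- a / (norm x)\<^sup>2"] have "0 \<le> - (a\<^sup>2 / (norm x)\<^sup>2)"
      using False by (simp add: power2_eq_square divide_simps)
    then have "a\<^sup>2 \<le> 0" using False by (simp add: divide_le_0_iff zero_le_divide_iff)
    then show ?thesis by (simp add: a_def)
  qed
  then show ?thesis by (rule that)
qed

text \<open>The orthogonal complement of a finite set has finite codimension.  Passing from \<open>B\<close> to
  \<open>insert b B\<close> costs at most one more dimension: either \<open>b\<close> imposes no new condition, or some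
  \<open>u\<close> orthogonal to \<open>B\<close> has \<open>u \<bullet> b \<noteq> 0\<close> and a multiple of it corrects the remaining
  component.\<close>

lemma finite_set_orthogonal_decomposition:
  fixes B :: "'a::real_inner set"
  assumes "finite B"
  shows "\<exists>C. finite C \<and> (\<forall>x. \<exists>v\<in>span C. \<forall>b\<in>B. (x - v) \<bullet> b = 0)"
  using assms
proof (induction B)
  case empty
  then show ?case by (intro exI[of _ "{}"]) auto
next
  case (insert b B)
  then obtain C where "finite C" and C: "\<And>x. \<exists>v\<in>span C. \<forall>b\<in>B. (x - v) \<bullet> b = 0" by blast
  show ?case
  proof (cases "\<exists>u. (\<forall>b\<in>B. u \<bullet> b = 0) \<and> u \<bullet> b \<noteq> 0")
    case False
    then show ?thesis using \<open>finite C\<close> C by (intro exI[of _ C]) (metis insert_iff)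
  next
    case True
    then obtain u where u: "\<And>b. b \<in> B \<Longrightarrow> u \<bullet> b = 0" "u \<bullet> b \<noteq> 0" by blast
    have "\<exists>v\<in>span (insert u C). \<forall>b\<in>insert b B. (x - v) \<bullet> b = 0" for x
    proof -
      obtain v where v: "v \<in> span C" "\<And>b. b \<in> B \<Longrightarrow> (x - v) \<bullet> b = 0" using C by blast
      define k where "k = ((x - v) \<bullet> b) / (u \<bullet> b)"
      have "v + k *\<^sub>R u \<in> span (insert u C)"
        using v(1) span_mono[of C "insert u C"]
        by (intro span_add span_scale) (auto intro: span_base)
      moreover have "(x - (v + k *\<^sub>R u)) \<bullet> b' = 0" if "b' \<in> insert b B" for b'
        using that u v(2) by (auto simp: k_def inner_diff_left inner_add_left)
      ultimately show ?thesis by blast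
    qed
    then show ?thesis using \<open>finite C\<close> by (intro exI[of _ "insert u C"]) auto
  qed
qed

lemma exists_unit_vector_orthogonal_to_finite_set:
  fixes B :: "'a::real_inner set"
  assumes "infinite_dimensional TYPE('a)" "finite B"
  obtains e where "norm e = 1" "\<And>b. b \<in> B \<Longrightarrow> e \<bullet> b = 0"
proof -
  obtain C where "finite C" and C: "\<And>x. \<exists>v\<in>span C. \<forall>b\<in>B. (x - v) \<bullet> b = 0"
    using finite_set_orthogonal_decomposition[OF assms(2)] by blast
  then obtain x where x: "x \<notin> span C" using assms(1) unfolding infinite_dimensional_def by blast
  obtain v where v: "v \<in> span C" "\<And>b. b \<in> B \<Longrightarrow> (x - v) \<bullet> b = 0" using C by blast
  have "x - v \<noteq> 0" using x v(1) by auto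
  then show ?thesis
    by (intro that[of "(1 / norm (x - v)) *\<^sub>R (x - v)"]) (auto simp: v(2))
qed

section \<open>Every listed functional lies in the compactification\<close>

text \<open>A basic open set of the product topology restricts only finitely many coordinates, so exact
  agreement on finite sets is enough.\<close>

lemma closure_funI:
  fixes h :: "'a \<Rightarrow> 'b::topological_space"
  assumes "\<And>X. finite X \<Longrightarrow> \<exists>g\<in>S. \<forall>x\<in>X. g x = h x"
  shows "h \<in> closure S"
proof (rule ccontr)
  assume "h \<notin> closure S"
  then have "h \<in> - closure S" by simp
  moreover have "openin (product_topology (\<lambda>i. euclidean) UNIV) (- closure S)"
    by (metis euclidean_product_topology open_Compl closed_closure open_openin)
  ultimately obtain U where U: "h \<in> (\<Pi>\<^sub>E i\<in>UNIV. U i)" "finite {i. U i \<noteq> UNIV}"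
    "(\<Pi>\<^sub>E i\<in>UNIV. U i) \<subseteq> - closure S"
    using product_topology_open_contains_basis[of "\<lambda>_. euclidean" UNIV "- closure S" h] by auto
  obtain g where g: "g \<in> S" "\<And>x. U x \<noteq> UNIV \<Longrightarrow> g x = h x" using assms[OF U(2)] by blast
  have "g x \<in> U x" for x using g(2)[of x] U(1) by (cases "U x = UNIV") auto
  then have "g \<in> - closure S" using U(3) by (auto simp: PiE_def)
  then show False using g(1) closure_subset by blast
qed

lemma hilbert_finite_functional_in_compactification:
  fixes z :: "'a::{real_inner, banach}"
  assumes "infinite_dimensional TYPE('a)" "norm z \<le> c"
  shows "hilbert_finite_functional z c \<in> metric_compactification"
  unfolding metric_compactification_def
proof (rule closure_funI)
  fix X :: "'a set" assume "finite X"
  then obtain e where e: "norm e = 1" "\<And>b. b \<in> insert z X \<Longrightarrow> e \<bullet> b = 0"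
    using exists_unit_vector_orthogonal_to_finite_set[OF assms(1), of "insert z X"] by auto
  \<comment> \<open>\<open>e\<close> is orthogonal to \<open>z\<close> and to \<open>X\<close>: the added multiple raises the norm to \<open>c\<close> unseen by \<open>X\<close>\<close>
  define y where "y = z + sqrt (c\<^sup>2 - (norm z)\<^sup>2) *\<^sub>R e"
  have "0 \<le> c" using assms(2) norm_ge_zero[of z] by linarith
  have nonneg: "0 \<le> c\<^sup>2 - (norm z)\<^sup>2" using assms(2) by (simp add: power_mono)
  have "y \<bullet> y = z \<bullet> z + (c\<^sup>2 - (norm z)\<^sup>2)"
    using e(1) e(2)[of z] nonneg
    by (simp add: y_def algebra_simps inner_commute norm_eq_1 flip: power2_eq_square)
  then have norm_y: "norm y = c" using \<open>0 \<le> c\<close> by (simp add: norm_eq_sqrt_inner power2_norm_eq_inner)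
  have "internal_functional y x = hilbert_finite_functional z c x" if "x \<in> X" for x
  proof -
    have "x \<bullet> y = x \<bullet> z" using e(2)[of x] that by (simp add: y_def inner_add_right inner_commute)
    then have "(norm (x - y))\<^sup>2 = (norm x)\<^sup>2 - 2 * (x \<bullet> z) + c\<^sup>2"
      unfolding norm_y[symmetric] power2_norm_eq_inner by (simp add: algebra_simps inner_commute)
    then have "norm (x - y) = sqrt ((norm x)\<^sup>2 - 2 * (x \<bullet> z) + c\<^sup>2)"
      by (metis norm_ge_zero real_sqrt_unique)
    then show ?thesis by (simp add: internal_functional_def hilbert_finite_functional_def norm_y)
  qed
  then show "\<exists>g\<in>range internal_functional. \<forall>x\<in>X. g x = hilbert_finite_functional z c x" by blast
qed

lemma tendsto_pointwiseI:
  fixes l :: "'b \<Rightarrow> 'c::topological_space"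
  assumes "\<And>x. ((\<lambda>n. f n x) \<longlongrightarrow> l x) F"
  shows "(f \<longlongrightarrow> l) F"
proof -
  have "limitin (product_topology (\<lambda>_. euclidean) UNIV) f l F"
    unfolding limitin_componentwise limitin_canonical_iff topspace_product_topology
    using assms by auto
  then show ?thesis by (metis euclidean_product_topology limitin_canonical_iff)
qed

text \<open>Moving to infinity in the direction of \<open>z\<close> while keeping the ratio of the parameters fixed:
  \<open>sqrt (p - 2 n q + n\<^sup>2) - n\<close> tends to \<open>- q\<close>.  The condition \<open>\<parallel>z\<parallel> \<le> 1\<close> is what makes the parameters
  \<open>(n z, n)\<close> admissible.\<close>

lemma hilbert_linear_functional_in_compactification:
  fixes z :: "'a::{real_inner, banach}"
  assumes "infinite_dimensional TYPE('a)" "norm z \<le> 1"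
  shows "hilbert_linear_functional z \<in> metric_compactification"
proof -
  let ?f = "\<lambda>n::nat. hilbert_finite_functional (real n *\<^sub>R z) (real n)"
  have "?f n \<in> metric_compactification" for n
    using assms(2) by (intro hilbert_finite_functional_in_compactification assms(1)) (simp add: mult_left_le)
  moreover have "?f \<longlonglongrightarrow> hilbert_linear_functional z"
  proof (rule tendsto_pointwiseI)
    fix x
    have "(\<lambda>n::nat. sqrt (p - 2 * (real n * q) + (real n)\<^sup>2) - real n) \<longlonglongrightarrow> - q" for p q
      by real_asymp
    then show "(\<lambda>n. ?f n x) \<longlonglongrightarrow> hilbert_linear_functional z x"
      by (simp add: hilbert_finite_functional_def hilbert_linear_functional_def)
  qed
  ultimately show ?thesis
    unfolding metric_compactification_def by (intro Lim_in_closed_set[OF closed_closure]) auto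
qed

section \<open>The compactification contains nothing else\<close>

text \<open>The parameter \<open>\<sigma>\<close> is a limit value of \<open>\<parallel>y\<parallel> / (1 + \<parallel>y\<parallel>)\<close> along points \<open>y\<close> whose functionals
  approach \<open>h\<close>, and \<open>z\<close> is the weak limit of \<open>y / (1 + \<parallel>y\<parallel>)\<close>.  The closing inequality is the
  limit of \<open>\<parallel>x - y\<parallel> / (1 + \<parallel>y\<parallel>) \<ge> 0\<close>; it selects the nonnegative square root when the
  quadratic equation for \<open>h x\<close> is solved.  Filters are used because the product topology on
  functions need not be first countable, so sequences may not suffice.\<close>

lemma metric_functional_rescaled_limit:
  fixes h :: "'a::{real_inner, banach} \<Rightarrow> real"
  assumes "h \<in> metric_compactification"
  obtains \<sigma> z where "0 \<le> \<sigma>" "\<sigma> \<le> 1" "norm z \<le> \<sigma>"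
    "\<And>x. 2 * h x * \<sigma> + 2 * (x \<bullet> z) = (1 - \<sigma>) * ((norm x)\<^sup>2 - (h x)\<^sup>2)"
    "\<And>x. 0 \<le> h x * (1 - \<sigma>) + \<sigma>"
proof -
  define G :: "'a filter" where "G = filtercomap internal_functional (nhds h)"
  define s :: "'a \<Rightarrow> real" where "s = (\<lambda>y. norm y / (1 + norm y))"
  define w :: "'a \<Rightarrow> 'a" where "w = (\<lambda>y. (1 / (1 + norm y)) *\<^sub>R y)"
  have "G \<noteq> bot"
    unfolding G_def
  proof (rule filtercomap_neq_bot)
    fix P assume "eventually P (nhds h)"
    then obtain U where "open U" "h \<in> U" "\<And>g. g \<in> U \<Longrightarrow> P g" by (auto simp: eventually_nhds)
    then show "\<exists>y. P (internal_functional y)"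
      using assms open_Int_closure_eq_empty[of U "range internal_functional"]
      unfolding metric_compactification_def by blast
  qed
  have s_range: "s y \<in> {0..1}" for y
  proof -
    have "0 < 1 + norm y" by (simp add: add_pos_nonneg)
    then show ?thesis by (simp add: s_def pos_divide_le_eq)
  qed
  have one_minus_s: "1 - s y = 1 / (1 + norm y)" for y
  proof -
    have "0 < 1 + norm y" by (simp add: add_pos_nonneg)
    then show ?thesis by (simp add: s_def field_simps)
  qed
  have "filtermap s G \<noteq> bot" using \<open>G \<noteq> bot\<close> by (simp add: filtermap_bot_iff)
  moreover have "eventually (\<lambda>t. t \<in> {0..1}) (filtermap s G)"
    unfolding eventually_filtermap using s_range by (intro always_eventually allI)
  ultimately obtain \<sigma> where \<sigma>: "\<sigma> \<in> {0..1}" "inf (nhds \<sigma>) (filtermap s G) \<noteq> bot"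
    using compact_filter[THEN iffD1, OF compact_Icc[of "0::real" 1]] by blast
  \<comment> \<open>the refinement of \<open>G\<close> along which \<open>s\<close> converges to its cluster point\<close>
  define F where "F = inf G (filtercomap s (nhds \<sigma>))"
  have F: "F \<noteq> bot"
  proof
    assume "F = bot"
    then obtain P Q where PQ: "eventually P G" "eventually Q (nhds \<sigma>)" "\<And>y. P y \<Longrightarrow> Q (s y) \<Longrightarrow> False"
      unfolding F_def trivial_limit_def eventually_inf eventually_filtercomap by blast
    have "eventually (\<lambda>t. \<not> Q t) (filtermap s G)"
      unfolding eventually_filtermap using PQ(1) by (rule eventually_mono) (use PQ(3) in blast)
    then have "eventually (\<lambda>_. False) (inf (nhds \<sigma>) (filtermap s G))"
      using PQ(2) unfolding eventually_inf by blast
    then show False using \<sigma>(2) by (simp add: trivial_limit_def)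
  qed
  have s_lim: "(s \<longlongrightarrow> \<sigma>) F"
    unfolding F_def by (rule tendsto_mono[OF inf_le2 filterlim_filtercomap])
  have "(internal_functional \<longlongrightarrow> h) F"
    unfolding F_def G_def by (rule tendsto_mono[OF inf_le1 filterlim_filtercomap])
  then have g_lim: "((\<lambda>y. internal_functional y x) \<longlongrightarrow> h x) F" for x
    by (rule continuous_on_tendsto_compose[OF continuous_on_product_coordinates]) auto
  have rescaled: "2 * internal_functional y x * s y + 2 * (x \<bullet> w y)
      = (1 - s y) * ((norm x)\<^sup>2 - (internal_functional y x)\<^sup>2)" for x y
  proof -
    define g where "g = internal_functional y x"
    have "(g + norm y)\<^sup>2 = (norm x)\<^sup>2 - 2 * (x \<bullet> y) + (norm y)\<^sup>2"
      unfolding g_def internal_functional_def power2_norm_eq_inner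
      by (simp add: power2_norm_eq_inner algebra_simps inner_commute)
    then have "2 * g * norm y + 2 * (x \<bullet> y) = (norm x)\<^sup>2 - g\<^sup>2"
      by (simp add: power2_sum)
    then have "(2 * g * norm y + 2 * (x \<bullet> y)) / (1 + norm y) = ((norm x)\<^sup>2 - g\<^sup>2) / (1 + norm y)" by simp
    then show ?thesis
      unfolding g_def[symmetric] one_minus_s by (simp add: s_def w_def add_divide_distrib)
  qed
  \<comment> \<open>the only possible limit of \<open>x \<bullet> w y\<close>, read off from \<open>rescaled\<close>\<close>
  define \<phi> where "\<phi> = (\<lambda>x. ((1 - \<sigma>) * ((norm x)\<^sup>2 - (h x)\<^sup>2) - 2 * h x * \<sigma>) / 2)"
  have \<phi>_lim: "((\<lambda>y. x \<bullet> w y) \<longlongrightarrow> \<phi> x) F" for x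
  proof -
    have "((\<lambda>y. ((1 - s y) * ((norm x)\<^sup>2 - (internal_functional y x)\<^sup>2)
        - 2 * internal_functional y x * s y) / 2) \<longlongrightarrow> \<phi> x) F"
      unfolding \<phi>_def by (intro tendsto_intros s_lim g_lim) auto
    then show ?thesis by (simp add: rescaled[symmetric])
  qed
  have bound: "\<bar>\<phi> x\<bar> \<le> norm x * \<sigma>" for x
  proof (rule tendsto_le[OF F])
    show "((\<lambda>y. norm x * s y) \<longlongrightarrow> norm x * \<sigma>) F" by (intro tendsto_intros s_lim)
    show "((\<lambda>y. \<bar>x \<bullet> w y\<bar>) \<longlongrightarrow> \<bar>\<phi> x\<bar>) F" by (intro tendsto_intros \<phi>_lim)
    have "norm (w y) = s y" for y by (simp add: w_def s_def)
    then show "\<forall>\<^sub>F y in F. \<bar>x \<bullet> w y\<bar> \<le> norm x * s y"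
      using Cauchy_Schwarz_ineq2[of x] by (intro always_eventually allI) metis
  qed
  have "bounded_linear \<phi>"
  proof (rule bounded_linear_intro)
    fix x x' :: 'a and r :: real
    show "\<phi> (x + x') = \<phi> x + \<phi> x'"
      using tendsto_add[OF \<phi>_lim[of x] \<phi>_lim[of x']] \<phi>_lim[of "x + x'"]
      by (intro tendsto_unique[OF F]) (auto simp: inner_add_left)
    show "\<phi> (r *\<^sub>R x) = r *\<^sub>R \<phi> x"
      using tendsto_mult_left[OF \<phi>_lim[of x], of r] \<phi>_lim[of "r *\<^sub>R x"]
      by (intro tendsto_unique[OF F]) auto
    show "norm (\<phi> x) \<le> norm x * \<sigma>" using bound by simp
  qed
  then obtain z where z: "\<And>x. \<phi> x = x \<bullet> z" using riesz_representation by blast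
  show thesis
  proof (rule that[of \<sigma> z])
    show "0 \<le> \<sigma>" "\<sigma> \<le> 1" using \<sigma>(1) by auto
    have "norm z * norm z \<le> norm z * \<sigma>"
      using bound[of z] by (simp add: z power2_norm_eq_inner[symmetric] power2_eq_square)
    then show "norm z \<le> \<sigma>" using \<open>0 \<le> \<sigma>\<close> by (cases "z = 0") auto
    show "2 * h x * \<sigma> + 2 * (x \<bullet> z) = (1 - \<sigma>) * ((norm x)\<^sup>2 - (h x)\<^sup>2)" for x
      unfolding z[symmetric] \<phi>_def by (simp add: field_simps)
    show "0 \<le> h x * (1 - \<sigma>) + \<sigma>" for x
    proof (rule tendsto_lowerbound[OF _ _ F])
      show "((\<lambda>y. internal_functional y x * (1 - s y) + s y) \<longlongrightarrow> h x * (1 - \<sigma>) + \<sigma>) F"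
        by (intro tendsto_intros s_lim g_lim)
      have "internal_functional y x * (1 - s y) + s y = norm (x - y) / (1 + norm y)" for y
        unfolding internal_functional_def one_minus_s by (simp add: s_def diff_divide_distrib)
      then show "\<forall>\<^sub>F y in F. 0 \<le> internal_functional y x * (1 - s y) + s y" by simp
    qed
  qed
qed

lemma metric_functional_cases:
  fixes h :: "'a::{real_inner, banach} \<Rightarrow> real"
  assumes "h \<in> metric_compactification"
  shows "(\<exists>z c. norm z \<le> c \<and> h = hilbert_finite_functional z c)
       \<or> (\<exists>z. norm z \<le> 1 \<and> h = hilbert_linear_functional z)"
proof -
  obtain \<sigma> z where \<sigma>: "0 \<le> \<sigma>" "\<sigma> \<le> 1" "norm z \<le> \<sigma>"
    and eq: "\<And>x. 2 * h x * \<sigma> + 2 * (x \<bullet> z) = (1 - \<sigma>) * ((norm x)\<^sup>2 - (h x)\<^sup>2)"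
    and nonneg: "\<And>x. 0 \<le> h x * (1 - \<sigma>) + \<sigma>"
    using metric_functional_rescaled_limit[OF assms] by blast
  show ?thesis
  proof (cases "\<sigma> = 1")
    case True
    then have "h x = - (x \<bullet> z)" for x using eq[of x] by simp
    then have "h = hilbert_linear_functional z" by (simp add: hilbert_linear_functional_def fun_eq_iff)
    then show ?thesis using \<sigma>(3) True by blast
  next
    case False
    define r where "r = 1 - \<sigma>"
    have r: "0 < r" "\<sigma> = 1 - r" using False \<sigma>(2) by (auto simp: r_def)
    define c where "c = \<sigma> / r"
    define z' where "z' = (1 / r) *\<^sub>R z"
    have "h x = hilbert_finite_functional z' c x" for x
    proof -
      have "2 * h x * c + 2 * (x \<bullet> z') = (2 * h x * \<sigma> + 2 * (x \<bullet> z)) / r"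
        using r by (simp add: c_def z'_def add_divide_distrib)
      also have "\<dots> = (norm x)\<^sup>2 - (h x)\<^sup>2" unfolding eq using r by simp
      finally have "(h x + c)\<^sup>2 = (norm x)\<^sup>2 - 2 * (x \<bullet> z') + c\<^sup>2" by (simp add: power2_sum)
      moreover have "h x + c = (h x * (1 - \<sigma>) + \<sigma>) / r" using r(1) by (simp add: c_def r_def add_divide_distrib)
      then have "0 \<le> h x + c" using nonneg[of x] r by simp
      ultimately have "h x + c = sqrt ((norm x)\<^sup>2 - 2 * (x \<bullet> z') + c\<^sup>2)"
        by (metis real_sqrt_unique)
      then show ?thesis by (simp add: hilbert_finite_functional_def)
    qed
    moreover have "norm z' \<le> c" using \<sigma>(3) r by (simp add: z'_def c_def divide_right_mono)
    ultimately show ?thesis by (metis ext)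
  qed
qed

section \<open>Finite functionals and functionals at infinity\<close>

lemma INF_finite_functional:
  fixes z :: "'a::{real_inner, banach}"
  assumes "norm z \<le> c"
  shows "(INF x. ereal (hilbert_finite_functional z c x)) > -\<infinity>"
proof -
  have "- c \<le> hilbert_finite_functional z c x" for x
  proof -
    have "x \<bullet> z \<le> norm x * norm z" by (rule norm_cauchy_schwarz)
    moreover have "0 \<le> (norm x - norm z)\<^sup>2" by simp
    moreover have "(norm z)\<^sup>2 \<le> c\<^sup>2" using assms by (simp add: power_mono)
    ultimately have "0 \<le> (norm x)\<^sup>2 - 2 * (x \<bullet> z) + c\<^sup>2" by (simp add: power2_diff)
    then show ?thesis by (simp add: hilbert_finite_functional_def)
  qed
  then have "ereal (- c) \<le> (INF x. ereal (hilbert_finite_functional z c x))"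
    by (intro INF_greatest) simp
  then show ?thesis by (auto simp: less_le_trans[rotated])
qed

lemma INF_linear_functional:
  fixes z :: "'a::{real_inner, banach}"
  assumes "z \<noteq> 0"
  shows "(INF x. ereal (hilbert_linear_functional z x)) = -\<infinity>"
proof (rule ereal_bot)
  fix B :: real
  have "hilbert_linear_functional z ((- B / (norm z)\<^sup>2) *\<^sub>R z) = B"
    using assms by (simp add: hilbert_linear_functional_def power2_norm_eq_inner)
  then show "(INF x. ereal (hilbert_linear_functional z x)) \<le> ereal B"
    by (metis INF_lower UNIV_I)
qed

theorem theorem4p4:
  assumes "infinite_dimensional TYPE('a::{real_inner, banach})"
  shows "(metric_compactification :: ('a \<Rightarrow> real) set)
           = finite_metric_functionals \<union> metric_functionals_at_infinity
       \<and> (finite_metric_functionals :: ('a \<Rightarrow> real) set) \<inter> metric_functionals_at_infinity = {}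
       \<and> (finite_metric_functionals :: ('a \<Rightarrow> real) set)
           = {hilbert_finite_functional z c | z c. c \<ge> norm z} \<union> {\<lambda>x. 0}
       \<and> (metric_functionals_at_infinity :: ('a \<Rightarrow> real) set)
           = {hilbert_linear_functional z | z. 0 < norm z \<and> norm z \<le> 1}"
proof -
  \<comment> \<open>The zero functional is the linear functional of \<open>0\<close>, the only linear one with finite infimum;
    hence it is listed separately among the finite functionals.\<close>
  let ?M = "metric_compactification :: ('a \<Rightarrow> real) set"
  have zero: "hilbert_linear_functional (0::'a) = (\<lambda>x. 0)"
    by (simp add: hilbert_linear_functional_def)
  have zero_INF: "(INF x::'a. ereal 0) > -\<infinity>" by simp
  have zero_in: "(\<lambda>x. 0) \<in> ?M"
    using hilbert_linear_functional_in_compactification[OF assms, of 0] by (simp add: zero)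
  have cases: "(\<exists>z c. norm z \<le> c \<and> h = hilbert_finite_functional z c) \<or> h = (\<lambda>x. 0)
      \<or> (\<exists>z. 0 < norm z \<and> norm z \<le> 1 \<and> h = hilbert_linear_functional z)" if "h \<in> ?M" for h
    using metric_functional_cases[OF that] zero by (metis zero_less_norm_iff)
  have partition: "?M = finite_metric_functionals \<union> metric_functionals_at_infinity"
    "(finite_metric_functionals :: ('a \<Rightarrow> real) set) \<inter> metric_functionals_at_infinity = {}"
    unfolding finite_metric_functionals_def metric_functionals_at_infinity_def by auto
  have fin: "{hilbert_finite_functional z c | z c. c \<ge> norm z} \<union> {\<lambda>x. 0}
      \<subseteq> (finite_metric_functionals :: ('a \<Rightarrow> real) set)"
    unfolding finite_metric_functionals_def
    using hilbert_finite_functional_in_compactification[OF assms] INF_finite_functional zero_in zero_INF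
    by blast
  have inf: "{hilbert_linear_functional z | z. 0 < norm z \<and> norm z \<le> 1}
      \<subseteq> (metric_functionals_at_infinity :: ('a \<Rightarrow> real) set)"
    unfolding metric_functionals_at_infinity_def
    using hilbert_linear_functional_in_compactification[OF assms] INF_linear_functional by auto
  have covered: "?M \<subseteq> ({hilbert_finite_functional z c | z c. c \<ge> norm z} \<union> {\<lambda>x. 0})
      \<union> {hilbert_linear_functional z | z. 0 < norm z \<and> norm z \<le> 1}"
    using cases by blast
  \<comment> \<open>two disjoint sets, each containing one part of a cover of their union, equal these parts\<close>
  have parts: "M = P \<union> Q \<Longrightarrow> P \<inter> Q = {} \<Longrightarrow> A \<subseteq> P \<Longrightarrow> B \<subseteq> Q \<Longrightarrow> M \<subseteq> A \<union> B \<Longrightarrow> P = A \<and> Q = B"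
    for M P Q A B :: "('a \<Rightarrow> real) set" by blast
  show ?thesis
    by (intro conjI partition parts[OF partition fin inf covered, THEN conjunct1]
        parts[OF partition fin inf covered, THEN conjunct2])
qed

end
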